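(* For every positive integer $n$, $$\sum_{T\in\mathsf{T}_n} t^{\operatorname{leg}(T)}=\sum_{\mathbf a\in\mathsf{PF}_n} t^{z(\mathbf a)}$$ as polynomials in $t$.
   Context: Let $[n]=\{1,\dots,n\}$. $\mathsf{T}_n$ is the set of labeled trees on the vertex set $\{0,1,\dots,n\}$, rooted at $0$. For $T\in\mathsf{T}_n$, run the depth-first search algorithm on $T$ starting at the root $0$, where at each vertex the algorithm moves to the unvisited neighbor of highest label. Let $\mathbf v(T)=(v_1,\dots,v_k)$ be the ordered list of vertices other than the root that are visited before the algorithm backtracks for the first time (if $T$ is a path with endpoint $0$, this is all non-root vertices), and let $\operatorname{leg}(T)=k$. $\mathsf{PF}_n$ is the set of parking functions of length $n$: tuples $\mathbf a=(a_1,\dots,a_n)$ of positive integers such that, for every $i\in[n]$, the $i$th smallest entry is at most $i$ (equivalently $|\{j: a_j\le i\}|\ge i$ for all $i\in[n]$). For $\mathbf a\in[n]^n$, the center $Z(\mathbf a)$ is the largest subset $X=\{x_1<\dots<x_\ell\}\subseteq[n]$ such that $a_{x_i}\le i$ for every $i\in[\ell]$, and $z(\mathbf a)=|Z(\mathbf a)|$. *)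

theory Defs
  imports "HOL-Computational_Algebra.Polynomial" "HOL-Library.FuncSet"
begin

text \<open>Labeled trees on the vertex set {0,...,n}, given by their (undirected) edge sets:
  a set of 2-element subsets of {0..n} with exactly n edges that connects every vertex to 0.\<close>

definition adj :: "nat set set \<Rightarrow> (nat \<times> nat) set" where
  "adj E = {(u, w). {u, w} \<in> E}"

definition labeled_trees :: "nat \<Rightarrow> nat set set set" where
  "labeled_trees n = {E. E \<subseteq> {{u, v} | u v. u \<noteq> v \<and> u \<le> n \<and> v \<le> n}
                        \<and> card E = n
                        \<and> (\<forall>v\<le>n. (0, v) \<in> (adj E)\<^sup>*)}"

text \<open>Depth-first search from the current vertex (head of the list of visited vertices,
  stored in reverse order), always moving to the unvisited neighbour of highest label,
  until no unvisited neighbour exists (i.e. until the first backtrack). The first argument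
  is fuel.\<close>

fun dfs_first_branch :: "nat set set \<Rightarrow> nat \<Rightarrow> nat list \<Rightarrow> nat list" where
  "dfs_first_branch E 0 vs = vs"
| "dfs_first_branch E (Suc k) vs =
     (let U = {w. {hd vs, w} \<in> E \<and> w \<notin> set vs}
      in if U = {} then vs else dfs_first_branch E k (Max U # vs))"

text \<open>v(T): the non-root vertices visited before the first backtrack, in order.\<close>
definition leg_vertices :: "nat \<Rightarrow> nat set set \<Rightarrow> nat list" where
  "leg_vertices n E = tl (rev (dfs_first_branch E (Suc n) [0]))"

definition leg :: "nat \<Rightarrow> nat set set \<Rightarrow> nat" where
  "leg n E = length (leg_vertices n E)"

text \<open>Parking functions of length n, as functions on {1..n} with positive integer values.\<close>
definition parking_functions :: "nat \<Rightarrow> (nat \<Rightarrow> nat) set" where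
  "parking_functions n = {a \<in> {1..n} \<rightarrow>\<^sub>E {1..}. \<forall>i\<in>{1..n}. card {j\<in>{1..n}. a j \<le> i} \<ge> i}"

text \<open>X = {x_1 < ... < x_l} satisfies a(x_i) \<le> i; the rank of x in X is |{y \<in> X. y \<le> x}|.\<close>
definition center_ok :: "nat \<Rightarrow> (nat \<Rightarrow> nat) \<Rightarrow> nat set \<Rightarrow> bool" where
  "center_ok n a X \<longleftrightarrow> X \<subseteq> {1..n} \<and> (\<forall>x\<in>X. a x \<le> card {y\<in>X. y \<le> x})"

text \<open>z(a) = size of the largest such subset (the center).\<close>
definition center_size :: "nat \<Rightarrow> (nat \<Rightarrow> nat) \<Rightarrow> nat" where
  "center_size n a = Max {card X | X. center_ok n a X}"

end

theory Submission
  imports Defs "HOL-Combinatorics.Multiset_Permutations"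
begin

text \<open>Fix a set \<open>X\<close> of \<open>k\<close> labels and let \<open>W\<close> be its complement in \<open>{1..n}\<close>.
  A tree whose first branch visits exactly \<open>X\<close> consists of an ordering of \<open>X\<close> (the branch) and a
  forest on \<open>W\<close>; a root \<open>w\<close> of the forest may hang from any branch vertex whose successor on the
  branch exceeds \<open>w\<close>, so it has as many choices as \<open>X\<close> has elements above \<open>w\<close>.
  The center of a parking function is found greedily from left to right. If it is \<open>X\<close>, the values
  on \<open>X\<close> can be chosen in \<open>k!\<close> ways, and a position \<open>w\<close> in \<open>W\<close> must exceed one plus the number of
  elements of \<open>X\<close> below \<open>w\<close>; the number of such values up to \<open>k + 1\<close> is again the number of
  elements of \<open>X\<close> above \<open>w\<close>. For the remaining parking condition all values up to \<open>k + 1\<close> are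
  equivalent, so they behave like the value \<open>1\<close> of a parking function on \<open>W\<close>.
  Thus it suffices that forests with root set \<open>S\<close> and parking functions whose ones are at \<open>S\<close> are
  equinumerous. Both satisfy the same recursion: removing \<open>S\<close> leaves a forest whose roots have
  \<open>card S\<close> possible parents, respectively a parking function in which the next \<open>card S\<close> values
  are equivalent.\<close>

section \<open>Forests and parking functions with restricted roots\<close>

text \<open>An extensional function on a disjoint union amounts to its two restrictions, so
  independent conditions on them multiply. The fiber counts below rest on this.\<close>

lemma card_split_extensional:
  assumes disj: "S \<inter> R = {}"
    and Q: "Q \<subseteq> extensional (S \<union> R)" and M: "M \<subseteq> extensional S" and N: "N \<subseteq> extensional R"
    and iff: "\<And>p. p \<in> extensional (S \<union> R) \<Longrightarrow> p \<in> Q \<longleftrightarrow> restrict p S \<in> M \<and> restrict p R \<in> N"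
  shows "card Q = card M * card N"
proof -
  have "bij_betw (\<lambda>p. (restrict p S, restrict p R)) Q (M \<times> N)"
  proof (rule bij_betw_byWitness[where f' = "\<lambda>(f, g) x. if x \<in> S then f x else g x"])
    show "\<forall>p\<in>Q. (case (restrict p S, restrict p R) of (f, g) \<Rightarrow> \<lambda>x. if x \<in> S then f x else g x) = p"
      using Q by (fastforce simp: fun_eq_iff extensional_def)
    have glue: "restrict (\<lambda>x. if x \<in> S then f x else g x) S = f \<and>
        restrict (\<lambda>x. if x \<in> S then f x else g x) R = g \<and>
        (\<lambda>x. if x \<in> S then f x else g x) \<in> extensional (S \<union> R)" if "f \<in> M" "g \<in> N" for f g
    proof -
      have "f \<in> extensional S" "g \<in> extensional R" using that M N by auto
      thus ?thesis using disj by (auto simp: fun_eq_iff extensional_def)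
    qed
    show "\<forall>a'\<in>M \<times> N. (restrict ((\<lambda>(f, g) x. if x \<in> S then f x else g x) a') S,
        restrict ((\<lambda>(f, g) x. if x \<in> S then f x else g x) a') R) = a'"
      using glue by auto
    show "(\<lambda>p. (restrict p S, restrict p R)) ` Q \<subseteq> M \<times> N"
      using iff Q by auto
    show "(\<lambda>(f, g) x. if x \<in> S then f x else g x) ` (M \<times> N) \<subseteq> Q"
    proof clarify
      fix f g assume "f \<in> M" "g \<in> N"
      with glue[OF this] iff[of "\<lambda>x. if x \<in> S then f x else g x"]
      show "(\<lambda>x. if x \<in> S then f x else g x) \<in> Q" by simp
    qed
  qed
  thus ?thesis by (simp add: bij_betw_same_card card_cartesian_product)
qed

lemma card_fibers:
  assumes "finite A" "finite I" "f ` A \<subseteq> I"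
  shows "card A = (\<Sum>i\<in>I. card {x \<in> A. f x = i})"
  using sum.group[OF assms, of "\<lambda>_. 1::nat"] by simp

text \<open>Forests are encoded by their parent functions; a root \<open>w\<close> has its parent in \<open>G w\<close>,
  outside \<open>W\<close>. The rank function \<open>d\<close> expresses acyclicity.\<close>

definition forests :: "'a set \<Rightarrow> ('a \<Rightarrow> 'a set) \<Rightarrow> ('a \<Rightarrow> 'a) set" where
  "forests W G = {p \<in> PiE W (\<lambda>w. W \<union> G w).
     \<exists>d::'a \<Rightarrow> nat. \<forall>w\<in>W. p w \<in> W \<longrightarrow> d (p w) < d w}"

text \<open>With \<open>m = 1\<close> and \<open>H w = {1}\<close> these are the ordinary parking functions on \<open>W\<close>: all values up to
  \<open>m\<close> play the role of the value \<open>1\<close>, and \<open>H w\<close> lists those available at \<open>w\<close>.\<close>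

definition parkings :: "'a set \<Rightarrow> nat \<Rightarrow> ('a \<Rightarrow> nat set) \<Rightarrow> ('a \<Rightarrow> nat) set" where
  "parkings W m H = {b \<in> PiE W (\<lambda>w. H w \<union> {m<..}).
     \<forall>i<card W. i < card {w \<in> W. b w \<le> m + i}}"

lemma forests_rank:
  assumes "p \<in> forests W G" "\<And>w. w \<in> W \<Longrightarrow> G w \<inter> W = {}"
  obtains d :: "'a \<Rightarrow> nat" where "\<And>w. w \<in> W \<Longrightarrow> d (p w) < d w"
proof -
  obtain d :: "'a \<Rightarrow> nat" where d: "\<forall>w\<in>W. p w \<in> W \<longrightarrow> d (p w) < d w"
    using assms(1) by (auto simp: forests_def)
  \<comment> \<open>Rank 0 outside \<open>W\<close> and a shift by one inside make the step from a
    root to its parent descend as well.\<close>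
  show ?thesis
    by (rule that[of "\<lambda>v. if v \<in> W then Suc (d v) else 0"]) (use d in auto)
qed

lemma finite_forests: "finite W \<Longrightarrow> (\<And>w. w \<in> W \<Longrightarrow> finite (G w)) \<Longrightarrow> finite (forests W G)"
  by (rule finite_subset[of _ "PiE W (\<lambda>w. W \<union> G w)"]) (auto simp: forests_def intro!: finite_PiE)

text \<open>Although \<open>{m<..}\<close> is unbounded, the inequality with the last index
  \<open>card W - 1\<close> forces all values below \<open>m + card W\<close>.\<close>

lemma finite_parkings:
  assumes "finite W"
  shows "finite (parkings W m H)"
proof (rule finite_subset)
  show "finite (PiE W (\<lambda>w. {..m + card W}))" using assms by (intro finite_PiE) auto
  show "parkings W m H \<subseteq> PiE W (\<lambda>w. {..m + card W})"
  proof
    fix b assume b: "b \<in> parkings W m H"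
    have "b w \<le> m + card W" if "w \<in> W" for w
    proof -
      have pos: "card W > 0" using that assms by (auto simp: card_gt_0_iff)
      have "\<forall>i<card W. i < card {w \<in> W. b w \<le> m + i}" using b by (simp add: parkings_def)
      from this[rule_format, of "card W - 1"] pos
      have "card W - 1 < card {w \<in> W. b w \<le> m + (card W - 1)}" by linarith
      hence "card W \<le> card {w \<in> W. b w \<le> m + (card W - 1)}" by linarith
      hence "{w \<in> W. b w \<le> m + (card W - 1)} = W"
        using assms by (intro card_seteq) auto
      with that have "b w \<le> m + (card W - 1)" by blast
      thus ?thesis by linarith
    qed
    with b show "b \<in> PiE W (\<lambda>w. {..m + card W})" by (auto simp: parkings_def PiE_def)
  qed
qed

section \<open>Removing the root set: the common recursion\<close>

lemma forests_no_roots: "finite W \<Longrightarrow> W \<noteq> {} \<Longrightarrow> forests W (\<lambda>_. {}) = {}"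
proof (rule ccontr)
  assume W: "finite W" "W \<noteq> {}" and "forests W (\<lambda>_. {}) \<noteq> {}"
  then obtain p d where p: "p \<in> PiE W (\<lambda>w. W)" "\<forall>w\<in>W. p w \<in> W \<longrightarrow> (d (p w) :: nat) < d w"
    by (auto simp: forests_def)
  \<comment> \<open>A vertex of least rank cannot have its parent in \<open>W\<close>.\<close>
  obtain w where "w \<in> W" "\<forall>v\<in>W. d w \<le> d v"
    using W by (metis arg_min_if_finite(1) arg_min_least)
  with p show False by (meson PiE_mem not_le)
qed

text \<open>Sort by the set \<open>S\<close> of roots. Their parents are free choices from
  \<open>G\<close>; deleting \<open>S\<close> leaves a forest whose roots may hang from any element
  of \<open>S\<close>. The empty \<open>S\<close> contributes nothing because of
  \<open>forests_no_roots\<close>.\<close>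

lemma card_forests_rec:
  assumes W: "finite W" "W \<noteq> {}" and G: "\<And>w. w \<in> W \<Longrightarrow> finite (G w)" "\<And>w. w \<in> W \<Longrightarrow> G w \<inter> W = {}"
  shows "card (forests W G) =
    (\<Sum>S\<in>Pow W - {{}}. (\<Prod>w\<in>S. card (G w)) * card (forests (W - S) (\<lambda>_. S)))"
proof -
  let ?f = "\<lambda>p. {w \<in> W. p w \<notin> W}"
  have fib: "card {p \<in> forests W G. ?f p = S} = (\<Prod>w\<in>S. card (G w)) * card (forests (W - S) (\<lambda>_. S))"
    if S: "S \<subseteq> W" for S
  proof -
    have fS: "finite S" using S W finite_subset by blast
    have U: "S \<union> (W - S) = W" using S by auto
    have "card {p \<in> forests W G. ?f p = S} = card (PiE S G) * card (forests (W - S) (\<lambda>_. S))"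
    proof (rule card_split_extensional[where S=S and R="W - S"], unfold U)
      show "S \<inter> (W - S) = {}" by auto
      show "{p \<in> forests W G. ?f p = S} \<subseteq> extensional W" by (auto simp: forests_def PiE_def)
      show "PiE S G \<subseteq> extensional S" by (auto simp: PiE_def)
      show "forests (W - S) (\<lambda>_. S) \<subseteq> extensional (W - S)" by (auto simp: forests_def PiE_def)
      fix p :: "'a \<Rightarrow> 'a" assume p: "p \<in> extensional W"
      show "p \<in> {p \<in> forests W G. ?f p = S} \<longleftrightarrow>
        restrict p S \<in> PiE S G \<and> restrict p (W - S) \<in> forests (W - S) (\<lambda>_. S)"
      proof
        assume L: "p \<in> {p \<in> forests W G. ?f p = S}"
        then obtain d :: "'a \<Rightarrow> nat" where d: "\<forall>w\<in>W. p w \<in> W \<longrightarrow> d (p w) < d w"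
          by (auto simp: forests_def)
        have "\<exists>d::'a \<Rightarrow> nat. \<forall>w\<in>W - S. p w \<in> W - S \<longrightarrow> d (p w) < d w"
          using d by (intro exI[of _ d]) auto
        moreover have "\<And>w. w \<in> S \<Longrightarrow> p w \<in> G w" "\<And>w. w \<in> W - S \<Longrightarrow> p w \<in> W"
          using L by (auto simp: forests_def PiE_def Pi_def)
        ultimately show "restrict p S \<in> PiE S G \<and> restrict p (W - S) \<in> forests (W - S) (\<lambda>_. S)"
          using S by (auto simp: forests_def)
      next
        assume R: "restrict p S \<in> PiE S G \<and> restrict p (W - S) \<in> forests (W - S) (\<lambda>_. S)"
        hence pS: "p w \<in> G w" if "w \<in> S" for w using that by (metis PiE_mem restrict_apply')
        have pR: "p w \<in> W" if "w \<in> W - S" for w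
          using R that S by (force simp: forests_def PiE_def Pi_def)
        obtain d :: "'a \<Rightarrow> nat" where d: "\<forall>w\<in>W - S. p w \<in> W - S \<longrightarrow> d (p w) < d w"
          using R by (auto simp: forests_def)
        \<comment> \<open>Roots get rank 0 and all other ranks move up by one, so vertices hanging
          from \<open>S\<close> also descend.\<close>
        have "\<exists>d::'a \<Rightarrow> nat. \<forall>w\<in>W. p w \<in> W \<longrightarrow> d (p w) < d w"
          using d pS G(2) S by (intro exI[of _ "\<lambda>w. if w \<in> S then 0 else Suc (d w)"]) fastforce
        moreover have "?f p = S" using pS pR G(2) S by blast
        moreover have "p w \<in> W \<union> G w" if "w \<in> W" for w using pS pR that by blast
        ultimately show "p \<in> {p \<in> forests W G. ?f p = S}"
          using p by (simp add: forests_def PiE_iff)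
      qed
    qed
    thus ?thesis using fS by (simp add: card_PiE)
  qed
  have "card (forests W G) = (\<Sum>S\<in>Pow W. card {p \<in> forests W G. ?f p = S})"
    using W G by (intro card_fibers finite_forests) auto
  also have "\<dots> = (\<Sum>S\<in>Pow W. (\<Prod>w\<in>S. card (G w)) * card (forests (W - S) (\<lambda>_. S)))"
    using fib by (intro sum.cong) auto
  also have "\<dots> = (\<Sum>S\<in>Pow W - {{}}. (\<Prod>w\<in>S. card (G w)) * card (forests (W - S) (\<lambda>_. S)))"
    proof (intro sum.mono_neutral_right ballI)
    fix S assume "S \<in> Pow W - (Pow W - {{}})"
    hence "S = {}" by blast
    thus "(\<Prod>w\<in>S. card (G w)) * card (forests (W - S) (\<lambda>_. S)) = 0"
      by (simp add: forests_no_roots[OF W])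
  qed (use W in auto)
  finally show ?thesis .
qed

text \<open>Sort by the set \<open>S\<close> of positions with value at most \<open>m\<close>. Once
  \<open>S\<close> is removed, the values in \<open>{m<..m + card S}\<close> are interchangeable for
  the remaining inequalities, so the threshold rises to \<open>m + card S\<close>.\<close>

lemma card_parkings_rec:
  assumes W: "finite W" "W \<noteq> {}" and H: "\<And>w. w \<in> W \<Longrightarrow> H w \<subseteq> {..m}"
  shows "card (parkings W m H) =
    (\<Sum>S\<in>Pow W - {{}}. (\<Prod>w\<in>S. card (H w)) *
       card (parkings (W - S) (m + card S) (\<lambda>_. {m<..m + card S})))"
proof -
  let ?f = "\<lambda>b. {w \<in> W. b w \<le> m}"
  have fib: "card {b \<in> parkings W m H. ?f b = S} = (\<Prod>w\<in>S. card (H w)) *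
       card (parkings (W - S) (m + card S) (\<lambda>_. {m<..m + card S}))"
    if S: "S \<subseteq> W" "S \<noteq> {}" for S
  proof -
    let ?N = "parkings (W - S) (m + card S) (\<lambda>_. {m<..m + card S})"
    have fS: "finite S" using S W finite_subset by blast
    have U: "S \<union> (W - S) = W" using S by auto
    have cW: "card W = card S + card (W - S)"
      using W S fS by (metis card_Diff_subset card_mono le_add_diff_inverse)
    have "card {b \<in> parkings W m H. ?f b = S} = card (PiE S H) * card ?N"
    proof (rule card_split_extensional[where S=S and R="W - S"], unfold U)
      show "S \<inter> (W - S) = {}" by auto
      show "{b \<in> parkings W m H. ?f b = S} \<subseteq> extensional W" by (auto simp: parkings_def PiE_def)
      show "PiE S H \<subseteq> extensional S" by (auto simp: PiE_def)
      show "?N \<subseteq> extensional (W - S)" by (auto simp: parkings_def PiE_def)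
      fix b :: "'a \<Rightarrow> nat" assume b: "b \<in> extensional W"
      have cnt: "card {w \<in> W. b w \<le> m + i} = card S + card {w \<in> W - S. b w \<le> m + i}"
        if "?f b = S" for i
      proof -
        have "{w \<in> W. b w \<le> m + i} = S \<union> {w \<in> W - S. b w \<le> m + i}" using that by auto
        moreover have "card (S \<union> {w \<in> W - S. b w \<le> m + i}) = card S + card {w \<in> W - S. b w \<le> m + i}"
          using W fS by (intro card_Un_disjoint) auto
        ultimately show ?thesis by simp
      qed
      \<comment> \<open>\<open>S\<close> alone settles the indices below \<open>card S\<close>;
        index \<open>card S + i\<close> on \<open>W\<close> is index \<open>i\<close> on
        \<open>W - S\<close>.\<close>
      have cond: "(\<forall>i<card W. i < card {w \<in> W. b w \<le> m + i}) \<longleftrightarrow>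
          (\<forall>i<card (W - S). i < card {w \<in> W - S. b w \<le> m + card S + i})" if "?f b = S"
      proof
        assume A: "\<forall>i<card W. i < card {w \<in> W. b w \<le> m + i}"
        show "\<forall>i<card (W - S). i < card {w \<in> W - S. b w \<le> m + card S + i}"
        proof (intro allI impI)
          fix i assume "i < card (W - S)"
          hence "card S + i < card {w \<in> W. b w \<le> m + (card S + i)}" using A cW by simp
          thus "i < card {w \<in> W - S. b w \<le> m + card S + i}"
            using cnt[OF that, of "card S + i"] by (simp add: add.assoc)
        qed
      next
        assume A: "\<forall>i<card (W - S). i < card {w \<in> W - S. b w \<le> m + card S + i}"
        show "\<forall>i<card W. i < card {w \<in> W. b w \<le> m + i}"
        proof (intro allI impI)
          fix i assume i: "i < card W"
          show "i < card {w \<in> W. b w \<le> m + i}"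
          proof (cases "i < card S")
            case False
            hence "i - card S < card (W - S)" "m + card S + (i - card S) = m + i" using i cW by auto
            with A[rule_format, of "i - card S"]
            have "i - card S < card {w \<in> W - S. b w \<le> m + i}" by simp
            thus ?thesis using False cnt[OF that, of i] by simp
          qed (use cnt[OF that, of i] in auto)
        qed
      qed
      show "b \<in> {b \<in> parkings W m H. ?f b = S} \<longleftrightarrow> restrict b S \<in> PiE S H \<and> restrict b (W - S) \<in> ?N"
      proof
        assume L: "b \<in> {b \<in> parkings W m H. ?f b = S}"
        hence f: "?f b = S" and "\<forall>w\<in>W. b w \<in> H w \<union> {m<..}"
          and "\<forall>i<card W. i < card {w \<in> W. b w \<le> m + i}"
          by (auto simp: parkings_def PiE_def Pi_def)
        moreover have "{w \<in> W - S. restrict b (W - S) w \<le> k} = {w \<in> W - S. b w \<le> k}" for k by auto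
        ultimately show "restrict b S \<in> PiE S H \<and> restrict b (W - S) \<in> ?N"
          using S cond[OF f] by (auto simp: parkings_def)
      next
        assume R: "restrict b S \<in> PiE S H \<and> restrict b (W - S) \<in> ?N"
        hence bS: "b w \<in> H w" if "w \<in> S" for w using that by (metis PiE_mem restrict_apply')
        have bR: "b w > m" if "w \<in> W - S" for w
          using R that by (force simp: parkings_def PiE_def Pi_def)
        have bm: "b w \<le> m" if "w \<in> S" for w using bS[OF that] H[of w] S that by blast
        have f: "?f b = S"
        proof (intro set_eqI iffI)
          fix w assume "w \<in> ?f b"
          thus "w \<in> S" using bR[of w] by (cases "w \<in> S") auto
        qed (use bm S in auto)
        have "{w \<in> W - S. restrict b (W - S) w \<le> k} = {w \<in> W - S. b w \<le> k}" for k by auto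
        hence "\<forall>i<card (W - S). i < card {w \<in> W - S. b w \<le> m + card S + i}"
          using R by (auto simp: parkings_def)
        moreover have "b w \<in> H w \<union> {m<..}" if "w \<in> W" for w
          using bS bR that by (cases "w \<in> S") auto
        ultimately show "b \<in> {b \<in> parkings W m H. ?f b = S}"
          using f cond[OF f] b by (simp add: parkings_def PiE_iff)
      qed
    qed
    thus ?thesis using fS by (simp add: card_PiE)
  qed
  have "?f ` parkings W m H \<subseteq> Pow W - {{}}"
  proof
    fix S assume "S \<in> ?f ` parkings W m H"
    then obtain b where b: "b \<in> parkings W m H" "S = ?f b" by blast
    have "0 < card W" using W by (simp add: card_gt_0_iff)
    \<comment> \<open>The inequality with index 0 makes \<open>S\<close> nonempty.\<close>
    hence "0 < card {w \<in> W. b w \<le> m + 0}" using b(1) by (simp only: parkings_def) blast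
    thus "S \<in> Pow W - {{}}" using b(2) by (auto simp: card_gt_0_iff)
  qed
  hence "card (parkings W m H) = (\<Sum>S\<in>Pow W - {{}}. card {b \<in> parkings W m H. ?f b = S})"
    using W by (intro card_fibers finite_parkings) auto
  also have "\<dots> = (\<Sum>S\<in>Pow W - {{}}. (\<Prod>w\<in>S. card (H w)) *
       card (parkings (W - S) (m + card S) (\<lambda>_. {m<..m + card S})))"
    using fib by (intro sum.cong) auto
  finally show ?thesis .
qed

text \<open>The two recursions agree term by term. Arbitrary \<open>G\<close>, \<open>H\<close> and
  \<open>m\<close> keep the induction closed: in the smaller instance every root has the
  \<open>card S\<close> parents in \<open>S\<close>, and every position the \<open>card S\<close>
  low values \<open>{m<..m + card S}\<close>.\<close>

lemma card_forests_eq_parkings: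
  assumes "finite W" "\<And>w. w \<in> W \<Longrightarrow> finite (G w)" "\<And>w. w \<in> W \<Longrightarrow> G w \<inter> W = {}"
    "\<And>w. w \<in> W \<Longrightarrow> H w \<subseteq> {..m}" "\<And>w. w \<in> W \<Longrightarrow> card (G w) = card (H w)"
  shows "card (forests W G) = card (parkings W m H)"
  using assms
proof (induction "card W" arbitrary: W G H m rule: less_induct)
  case less
  show ?case
  proof (cases "W = {}")
    case True
    thus ?thesis by (simp add: forests_def parkings_def)
  next
    case False
    have "(\<Prod>w\<in>S. card (G w)) * card (forests (W - S) (\<lambda>_. S)) =
        (\<Prod>w\<in>S. card (H w)) * card (parkings (W - S) (m + card S) (\<lambda>_. {m<..m + card S}))"
      if S: "S \<in> Pow W - {{}}" for S
    proof -
      have "finite S" using S less.prems(1) finite_subset by auto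
      moreover have "card (W - S) < card W"
        using S less.prems(1) by (intro psubset_card_mono) auto
      ultimately have "card (forests (W - S) (\<lambda>_. S)) =
          card (parkings (W - S) (m + card S) (\<lambda>_. {m<..m + card S}))"
        using less.prems(1) by (intro less.hyps) auto
      moreover have "(\<Prod>w\<in>S. card (G w)) = (\<Prod>w\<in>S. card (H w))"
        using S less.prems(5) by (intro prod.cong) auto
      ultimately show ?thesis by simp
    qed
    thus ?thesis
      using card_forests_rec[of W G] card_parkings_rec[of W H m] less.prems False by simp
  qed
qed

section \<open>Trees and parent functions\<close>

definition tree_of :: "nat \<Rightarrow> (nat \<Rightarrow> nat) \<Rightarrow> nat set set" where
  "tree_of n p = (\<lambda>v. {v, p v}) ` {1..n}"

text \<open>A tree rooted at 0 is a forest on \<open>{1..n}\<close> in which 0 is the only parent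
  available to a root.\<close>

abbreviation parent_functions :: "nat \<Rightarrow> (nat \<Rightarrow> nat) set" where
  "parent_functions n \<equiv> forests {1..n} (\<lambda>_. {0})"

lemma parent_functionsE:
  assumes "p \<in> parent_functions n"
  obtains d :: "nat \<Rightarrow> nat" where "\<And>v. v \<in> {1..n} \<Longrightarrow> d (p v) < d v"
    and "\<And>v. v \<in> {1..n} \<Longrightarrow> p v \<le> n"
proof -
  have "p v \<le> n" if "v \<in> {1..n}" for v
    using assms that by (fastforce simp: forests_def PiE_def Pi_def)
  moreover obtain d :: "nat \<Rightarrow> nat" where "\<And>v. v \<in> {1..n} \<Longrightarrow> d (p v) < d v"
    using forests_rank[OF assms] by auto
  ultimately show ?thesis using that by blast
qed

lemma edge_tree_of:
  "{u, w} \<in> tree_of n p \<longleftrightarrow> u \<in> {1..n} \<and> p u = w \<or> w \<in> {1..n} \<and> p w = u"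
  by (auto simp: tree_of_def doubleton_eq_iff)

text \<open>Two vertices yielding the same edge would be parents of each other, against the
  rank.\<close>

lemma card_tree_of:
  assumes "p \<in> parent_functions n"
  shows "card (tree_of n p) = n"
proof -
  obtain d :: "nat \<Rightarrow> nat" where d: "\<And>v. v \<in> {1..n} \<Longrightarrow> d (p v) < d v"
    by (rule forests_rank[OF assms]) auto
  have "inj_on (\<lambda>v. {v, p v}) {1..n}"
  proof (rule inj_onI)
    fix v w assume "v \<in> {1..n}" "w \<in> {1..n}" "{v, p v} = {w, p w}"
    with d[of v] d[of w] show "v = w" by (auto simp: doubleton_eq_iff)
  qed
  thus ?thesis by (simp add: tree_of_def card_image)
qed

text \<open>Connectivity follows by induction on the rank: the parent of a nonzero vertex is already
  reachable from 0.\<close>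

lemma tree_of_labeled_tree:
  assumes "p \<in> parent_functions n"
  shows "tree_of n p \<in> labeled_trees n"
proof -
  obtain d :: "nat \<Rightarrow> nat" where d: "\<And>v. v \<in> {1..n} \<Longrightarrow> d (p v) < d v"
    and le: "\<And>v. v \<in> {1..n} \<Longrightarrow> p v \<le> n"
    using parent_functionsE[OF assms] by blast
  have "(0, v) \<in> (adj (tree_of n p))\<^sup>*" if "v \<le> n" for v
    using that
  proof (induction "d v" arbitrary: v rule: less_induct)
    case less
    show ?case
    proof (cases "v = 0")
      case False
      hence v: "v \<in> {1..n}" using less.prems by auto
      hence "(0, p v) \<in> (adj (tree_of n p))\<^sup>*" using less.hyps d le by blast
      moreover have "(p v, v) \<in> adj (tree_of n p)" using v by (auto simp: adj_def edge_tree_of)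
      ultimately show ?thesis by (rule rtrancl.rtrancl_into_rtrancl)
    qed auto
  qed
  moreover have "tree_of n p \<subseteq> {{u, v} | u v. u \<noteq> v \<and> u \<le> n \<and> v \<le> n}"
  proof
    fix e assume "e \<in> tree_of n p"
    then obtain v where v: "v \<in> {1..n}" "e = {v, p v}" by (auto simp: tree_of_def)
    with d[of v] le[of v] have "v \<noteq> p v" "v \<le> n" "p v \<le> n" by auto
    with v show "e \<in> {{u, v} | u v. u \<noteq> v \<and> u \<le> n \<and> v \<le> n}" by blast
  qed
  ultimately show ?thesis using card_tree_of[OF assms] by (auto simp: labeled_trees_def)
qed

text \<open>Induction on the rank for \<open>p\<close>. If the edge \<open>{v, p v}\<close> came
  from \<open>p v\<close> in \<open>q\<close>, then \<open>q (p v) = v\<close>; but by induction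
  \<open>q (p v) = p (p v)\<close>, which has smaller rank than \<open>v\<close>.\<close>

lemma inj_on_tree_of: "inj_on (tree_of n) (parent_functions n)"
proof (rule inj_onI)
  fix p q assume p: "p \<in> parent_functions n" and q: "q \<in> parent_functions n"
    and eq: "tree_of n p = tree_of n q"
  obtain d :: "nat \<Rightarrow> nat" where d: "\<And>v. v \<in> {1..n} \<Longrightarrow> d (p v) < d v"
    by (rule forests_rank[OF p]) auto
  have pq: "p v = q v" if "v \<in> {1..n}" for v
    using that
  proof (induction "d v" arbitrary: v rule: less_induct)
    case less
    have "{v, p v} \<in> tree_of n p" using less.prems unfolding tree_of_def by (rule imageI)
    hence "{v, p v} \<in> tree_of n q" using eq by simp
    hence "q v = p v \<or> p v \<in> {1..n} \<and> q (p v) = v" by (auto simp: edge_tree_of)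
    moreover have False if "p v \<in> {1..n}" "q (p v) = v"
      using less.hyps[OF d[OF less.prems] that(1)] that d[OF less.prems] d[OF that(1)] by simp
    ultimately show ?case by auto
  qed
  show "p = q"
    by (rule extensionalityI[of _ "{1..n}"]) (use p q pq in \<open>auto simp: forests_def PiE_def\<close>)
qed

text \<open>Choose as parent a neighbour closer to 0, with the distance \<open>\<delta>\<close> as
  rank. The resulting \<open>n\<close> edges lie in \<open>E\<close>, which has only
  \<open>n\<close>.\<close>

lemma labeled_tree_parents:
  assumes "E \<in> labeled_trees n"
  obtains p where "p \<in> parent_functions n" "tree_of n p = E"
proof -
  have E: "E \<subseteq> {{u, v} | u v. u \<noteq> v \<and> u \<le> n \<and> v \<le> n}" "card E = n"
    and conn: "\<And>v. v \<le> n \<Longrightarrow> (0, v) \<in> (adj E)\<^sup>*"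
    using assms by (auto simp: labeled_trees_def)
  have finE: "finite E"
    by (rule finite_subset[OF E(1)], rule finite_subset[of _ "Pow {..n}"]) auto
  define \<delta> where "\<delta> v = (LEAST k. (0, v) \<in> adj E ^^ k)" for v
  have "\<exists>u. {v, u} \<in> E \<and> \<delta> u < \<delta> v" if v: "v \<in> {1..n}" for v
  proof -
    have "\<exists>k. (0, v) \<in> adj E ^^ k" using conn[of v] v by (auto simp: rtrancl_power)
    hence ex: "(0, v) \<in> adj E ^^ \<delta> v" unfolding \<delta>_def by (rule LeastI_ex)
    then obtain k where k: "\<delta> v = Suc k" using v by (cases "\<delta> v") auto
    with ex obtain u where u: "(0, u) \<in> adj E ^^ k" "(u, v) \<in> adj E" by auto
    have "\<delta> u \<le> k" unfolding \<delta>_def using u(1) by (rule Least_le)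
    with u k show ?thesis by (auto simp: adj_def insert_commute)
  qed
  then obtain q where q: "\<And>v. v \<in> {1..n} \<Longrightarrow> {v, q v} \<in> E \<and> \<delta> (q v) < \<delta> v" by metis
  define p where "p = restrict q {1..n}"
  have "q v \<le> n" if "v \<in> {1..n}" for v
    using q[OF that] E(1) by (fastforce simp: doubleton_eq_iff)
  hence "p \<in> PiE {1..n} (\<lambda>w. {1..n} \<union> {0})" by (fastforce simp: p_def)
  moreover have "\<exists>d::nat \<Rightarrow> nat. \<forall>w\<in>{1..n}. p w \<in> {1..n} \<longrightarrow> d (p w) < d w"
    using q by (intro exI[of _ \<delta>]) (auto simp: p_def)
  ultimately have p: "p \<in> parent_functions n" by (simp add: forests_def)
  have "tree_of n p \<subseteq> E" using q by (auto simp: tree_of_def p_def)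
  hence "tree_of n p = E" using card_subset_eq[OF finE] card_tree_of[OF p] E(2) by simp
  with p that show ?thesis by blast
qed

lemma bij_betw_tree_of: "bij_betw (tree_of n) (parent_functions n) (labeled_trees n)"
proof (rule bij_betw_imageI[OF inj_on_tree_of], intro subset_antisym subsetI)
  fix E assume "E \<in> labeled_trees n"
  thus "E \<in> tree_of n ` parent_functions n" using labeled_tree_parents by (metis imageI)
qed (use tree_of_labeled_tree in blast)

section \<open>The first branch of the depth-first search\<close>

text \<open>A specification of the first branch by parents alone, free of fuel and visited
  lists.\<close>

fun max_branch :: "(nat \<Rightarrow> nat) \<Rightarrow> nat set \<Rightarrow> nat \<Rightarrow> nat list \<Rightarrow> bool" where
  "max_branch p V u [] = (\<forall>w\<in>V. p w \<noteq> u)"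
| "max_branch p V u (v # vs) =
     (v \<in> V \<and> p v = u \<and> (\<forall>w\<in>V. p w = u \<longrightarrow> w \<le> v) \<and> max_branch p V v vs)"

lemma max_branch_unique: "max_branch p V u vs \<Longrightarrow> max_branch p V u vs' \<Longrightarrow> vs = vs'"
proof (induction vs arbitrary: u vs')
  case Nil
  thus ?case by (cases vs') auto
next
  case (Cons v vs)
  then obtain v' ws where "vs' = v' # ws" by (cases vs') auto
  with Cons show ?case by (metis max_branch.simps(2) order_antisym)
qed

text \<open>Indexed form: prepending the start vertex makes \<open>(u # vs) ! i\<close> the
  predecessor of \<open>vs ! i\<close>.\<close>

lemma max_branch_iff:
  "max_branch p V u vs \<longleftrightarrow>
     (\<forall>i<length vs. vs ! i \<in> V \<and> p (vs ! i) = (u # vs) ! i \<and>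
        (\<forall>w\<in>V. p w = (u # vs) ! i \<longrightarrow> w \<le> vs ! i)) \<and>
     (\<forall>w\<in>V. p w \<noteq> (u # vs) ! length vs)"
proof (induction vs arbitrary: u)
  case (Cons v vs)
  show ?case unfolding max_branch.simps Cons.IH
    by (simp add: All_less_Suc2 conj_assoc)
qed auto

text \<open>The search invariant: before the first backtrack, the reversed visited list is the chain
  of ancestors of the current vertex back to 0.\<close>

fun ancestral :: "(nat \<Rightarrow> nat) \<Rightarrow> nat \<Rightarrow> nat list \<Rightarrow> bool" where
  "ancestral p n [] = False"
| "ancestral p n [u] = (u = 0)"
| "ancestral p n (v # u # vs) = (v \<in> {1..n} \<and> p v = u \<and> ancestral p n (u # vs))"

lemma ancestral_rank:
  fixes d :: "nat \<Rightarrow> nat"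
  assumes "\<And>v. v \<in> {1..n} \<Longrightarrow> d (p v) < d v" "ancestral p n (u # vs)"
  shows "\<forall>x\<in>set vs. d x < d u"
  using assms(2)
proof (induction vs arbitrary: u)
  case (Cons v vs)
  thus ?case using assms(1)[of u] by fastforce
qed auto

lemma ancestral_distinct:
  fixes d :: "nat \<Rightarrow> nat"
  assumes "\<And>v. v \<in> {1..n} \<Longrightarrow> d (p v) < d v" "ancestral p n vs"
  shows "distinct vs \<and> set vs \<subseteq> {0..n}"
  using assms(2)
proof (induction vs)
  case (Cons v vs)
  have "v \<notin> set vs" using ancestral_rank[where d=d and p=p, OF assms(1) Cons.prems] by blast
  with Cons show ?case by (cases vs) auto
qed auto

text \<open>The unvisited neighbours of the current vertex are exactly its children: its parent is
  already visited, while children have larger rank than the whole chain.\<close>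

lemma dfs_first_branch_max_branch:
  fixes d :: "nat \<Rightarrow> nat"
  assumes d: "\<And>v. v \<in> {1..n} \<Longrightarrow> d (p v) < d v"
    and "ancestral p n vs" "n + 2 \<le> k + length vs"
  shows "\<exists>ws. dfs_first_branch (tree_of n p) k vs = rev ws @ vs \<and>
    max_branch p {1..n} (hd vs) ws \<and> ancestral p n (rev ws @ vs)"
  using assms(2,3)
proof (induction k arbitrary: vs)
  case 0
  \<comment> \<open>The fuel cannot run out: that would require \<open>n + 2\<close> distinct
    vertices in \<open>{0..n}\<close>.\<close>
  have "length vs \<le> card {0..n}"
    using ancestral_distinct[where d=d and p=p, OF d 0(1)] by (metis card_mono distinct_card finite_atLeastAtMost)
  with 0 show ?case by simp
next
  case (Suc k)
  then obtain u us where vs: "vs = u # us" by (cases vs) auto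
  let ?C = "{w \<in> {1..n}. p w = u}"
  have "w \<notin> set vs" if "w \<in> ?C" for w
    using that d[of w] ancestral_rank[where d=d and p=p and n=n and u=u and vs=us, OF d] Suc.prems(1) vs by fastforce
  moreover have "p u \<in> set vs" if "u \<in> {1..n}"
    using that Suc.prems(1) vs by (cases us) auto
  ultimately have U: "{w. {hd vs, w} \<in> tree_of n p \<and> w \<notin> set vs} = ?C"
    using vs by (auto simp: edge_tree_of)
  show ?case
  proof (cases "?C = {}")
    case True
    hence "dfs_first_branch (tree_of n p) (Suc k) vs = rev [] @ vs" by (simp add: U)
    moreover have "max_branch p {1..n} (hd vs) []" using True vs by auto
    ultimately show ?thesis using Suc.prems by (metis append_Nil rev.simps(1))
  next
    case False
    let ?v = "Max ?C"
    have v: "?v \<in> ?C" using False by (intro Max_in) auto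
    have vmax: "\<forall>w\<in>{1..n}. p w = u \<longrightarrow> w \<le> ?v" by auto
    have "ancestral p n (?v # vs)" using v Suc.prems vs by auto
    then obtain ws where ws: "dfs_first_branch (tree_of n p) k (?v # vs) = rev ws @ ?v # vs"
      "max_branch p {1..n} ?v ws" "ancestral p n (rev ws @ ?v # vs)"
      using Suc.IH[of "?v # vs"] Suc.prems by auto
    have "dfs_first_branch (tree_of n p) (Suc k) vs = rev (?v # ws) @ vs"
      using False ws(1) by (simp add: U Let_def)
    moreover have "max_branch p {1..n} (hd vs) (?v # ws)" using v vmax ws(2) vs by simp
    moreover have "ancestral p n (rev (?v # ws) @ vs)" using ws(3) by simp
    ultimately show ?thesis by blast
  qed
qed

lemma leg_vertices_tree_of:
  assumes "p \<in> parent_functions n"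
  defines "vs \<equiv> leg_vertices n (tree_of n p)"
  shows "max_branch p {1..n} 0 vs" "distinct vs" "set vs \<subseteq> {1..n}"
proof -
  obtain d :: "nat \<Rightarrow> nat" where d: "\<And>v. v \<in> {1..n} \<Longrightarrow> d (p v) < d v"
    by (rule forests_rank[OF assms(1)]) auto
  have "ancestral p n [0]" "n + 2 \<le> Suc n + length [0::nat]" by auto
  from dfs_first_branch_max_branch[where d=d and p=p, OF d this]
  obtain ws where ws: "dfs_first_branch (tree_of n p) (Suc n) [0] = rev ws @ [0]"
    "max_branch p {1..n} (hd [0]) ws" "ancestral p n (rev ws @ [0])" by blast
  have ds: "distinct (rev ws @ [0]) \<and> set (rev ws @ [0]) \<subseteq> {0..n}"
    using ancestral_distinct[where d=d and p=p, OF d ws(3)] .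
  have eq: "vs = ws" unfolding vs_def leg_vertices_def ws(1) by simp
  show "max_branch p {1..n} 0 vs" "distinct vs" using ws(2) ds eq by simp_all
  have "0 \<notin> set ws" "set ws \<subseteq> {0..n}" using ds by auto
  hence "set ws \<subseteq> {0..n} - {0}" by (simp add: subset_Diff_insert)
  also have "{0..n} - {0} = {1..n}" by auto
  finally show "set vs \<subseteq> {1..n}" using eq by simp
qed

lemma leg_vertices_eq_iff:
  "p \<in> parent_functions n \<Longrightarrow> leg_vertices n (tree_of n p) = vs \<longleftrightarrow> max_branch p {1..n} 0 vs"
  using leg_vertices_tree_of(1) max_branch_unique by blast

section \<open>Trees with a prescribed first branch\<close>

text \<open>The possible parents on the branch of a vertex \<open>w\<close> off it: the successor
  \<open>vs ! i\<close> must beat \<open>w\<close>. The last branch vertex is excluded, being a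
  leaf.\<close>

definition attach_set :: "nat list \<Rightarrow> nat \<Rightarrow> nat set" where
  "attach_set vs w = (\<lambda>i. (0 # vs) ! i) ` {i. i < length vs \<and> w < vs ! i}"

text \<open>Matching each such parent with its successor shows that the count depends only on the
  set of branch vertices, not on their order.\<close>

lemma card_attach_set:
  assumes "distinct (0 # vs)"
  shows "card (attach_set vs w) = card {x \<in> set vs. w < x}"
proof -
  let ?I = "{i. i < length vs \<and> w < vs ! i}"
  have "inj_on (\<lambda>i. (0 # vs) ! i) ?I"
    using inj_on_nth[OF assms, of ?I] by auto
  moreover have "inj_on (\<lambda>i. vs ! i) ?I"
    using assms inj_on_nth[of vs ?I] by auto
  moreover have "{x \<in> set vs. w < x} = (\<lambda>i. vs ! i) ` ?I"
    by (auto simp: in_set_conv_nth)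
  ultimately show ?thesis by (simp add: attach_set_def card_image)
qed

lemma card_leg_vertices_fiber:
  assumes vs: "distinct vs" "set vs \<subseteq> {1..n}"
  shows "card {p \<in> parent_functions n. leg_vertices n (tree_of n p) = vs} =
    card (forests ({1..n} - set vs) (attach_set vs))"
proof -
  let ?R = "{1..n} - set vs" and ?k = "length vs"
  \<comment> \<open>\<open>q x\<close> is the singleton of the predecessor of \<open>x\<close>; thus
    the branch admits exactly one parent assignment.\<close>
  define q where "q x = {(0 # vs) ! i | i. i < ?k \<and> vs ! i = x}" for x
  have dist: "distinct (0 # vs)" using vs by auto
  have nth_eq: "(0 # vs) ! i = (0 # vs) ! j \<longleftrightarrow> i = j" if "i \<le> ?k" "j \<le> ?k" for i j
    using nth_eq_iff_index_eq[OF dist, of i j] that by simp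
  have q: "q (vs ! i) = {(0 # vs) ! i}" if "i < ?k" for i
    using that vs(1) by (auto simp: q_def nth_eq_iff_index_eq)
  have pi_q: "(\<forall>x\<in>set vs. p x \<in> q x) \<longleftrightarrow> (\<forall>i<?k. p (vs ! i) = (0 # vs) ! i)" for p
    by (auto simp: all_set_conv_all_nth q)
  have "card (q x) = 1" if "x \<in> set vs" for x
    using that q by (auto simp: in_set_conv_nth)
  hence card1: "card (PiE (set vs) q) = 1" by (simp add: card_PiE)
  have U: "set vs \<union> ?R = {1..n}" using vs by auto
  have "card {p \<in> parent_functions n. max_branch p {1..n} 0 vs} =
      card (PiE (set vs) q) * card (forests ?R (attach_set vs))"
  proof (rule card_split_extensional[where S = "set vs" and R = ?R], unfold U)
    show "set vs \<inter> ?R = {}" by auto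
    show "{p \<in> parent_functions n. max_branch p {1..n} 0 vs} \<subseteq> extensional {1..n}"
      by (auto simp: forests_def PiE_def)
    show "PiE (set vs) q \<subseteq> extensional (set vs)" by (auto simp: PiE_def)
    show "forests ?R (attach_set vs) \<subseteq> extensional ?R" by (auto simp: forests_def PiE_def)
    fix p :: "nat \<Rightarrow> nat" assume ext: "p \<in> extensional {1..n}"
    show "p \<in> {p \<in> parent_functions n. max_branch p {1..n} 0 vs} \<longleftrightarrow>
      restrict p (set vs) \<in> PiE (set vs) q \<and> restrict p ?R \<in> forests ?R (attach_set vs)"
    proof
      assume L: "p \<in> {p \<in> parent_functions n. max_branch p {1..n} 0 vs}"
      hence path: "\<forall>i<?k. p (vs ! i) = (0 # vs) ! i \<and>
            (\<forall>w\<in>{1..n}. p w = (0 # vs) ! i \<longrightarrow> w \<le> vs ! i)"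
        and leaf: "\<forall>w\<in>{1..n}. p w \<noteq> (0 # vs) ! ?k"
        by (auto simp: max_branch_iff)
      obtain d :: "nat \<Rightarrow> nat" where d: "\<And>v. v \<in> {1..n} \<Longrightarrow> d (p v) < d v"
        and le: "\<And>v. v \<in> {1..n} \<Longrightarrow> p v \<le> n"
        using parent_functionsE L by blast
      \<comment> \<open>A parent on the branch is not its last vertex, and the search preferred the
        successor to \<open>w\<close>.\<close>
      have "p w \<in> ?R \<union> attach_set vs w" if w: "w \<in> ?R" for w
      proof (cases "p w \<in> ?R")
        case False
        hence "p w \<in> set (0 # vs)" using le[of w] w by auto
        then obtain i where i: "i < length (0 # vs)" "p w = (0 # vs) ! i"
          by (metis in_set_conv_nth)
        hence ik: "i < ?k" using leaf w by (metis Diff_iff length_Cons less_SucE)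
        moreover have "w \<noteq> vs ! i" using w ik by auto
        ultimately have "w < vs ! i" using path i w by (metis Diff_iff order_le_imp_less_or_eq)
        with ik i show ?thesis by (auto simp: attach_set_def)
      qed auto
      moreover have "\<exists>d::nat \<Rightarrow> nat. \<forall>w\<in>?R. p w \<in> ?R \<longrightarrow> d (p w) < d w"
        using d by blast
      moreover have "\<forall>x\<in>set vs. p x \<in> q x" using path pi_q by blast
      ultimately show "restrict p (set vs) \<in> PiE (set vs) q \<and>
          restrict p ?R \<in> forests ?R (attach_set vs)"
        by (auto simp: forests_def)
    next
      assume Rt: "restrict p (set vs) \<in> PiE (set vs) q \<and> restrict p ?R \<in> forests ?R (attach_set vs)"
      hence "\<forall>x\<in>set vs. p x \<in> q x" by (metis PiE_mem restrict_apply')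
      hence path: "p (vs ! i) = (0 # vs) ! i" if "i < ?k" for i using pi_q that by blast
      have pR: "p w \<in> ?R \<union> attach_set vs w" if "w \<in> ?R" for w
      proof -
        have "restrict p ?R w \<in> ?R \<union> attach_set vs w"
          using Rt that by (simp only: forests_def) blast
        thus ?thesis using that by simp
      qed
      obtain d :: "nat \<Rightarrow> nat" where d: "\<forall>w\<in>?R. restrict p ?R w \<in> ?R \<longrightarrow> d (restrict p ?R w) < d w"
        using Rt by (auto simp: forests_def)
      define idx where "idx = the_inv_into {..<length (0 # vs)} (\<lambda>i. (0 # vs) ! i)"
      have idx: "idx ((0 # vs) ! i) = i" if "i \<le> ?k" for i
        unfolding idx_def by (rule the_inv_into_f_f) (use inj_on_nth[OF dist] that in auto)
      have attach_sub: "attach_set vs w \<subseteq> insert 0 (set vs)" for w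
        by (auto simp: attach_set_def nth_Cons split: nat.splits)
      have pV: "p w \<in> {1..n} \<union> {0}" if w: "w \<in> {1..n}" for w
      proof (cases "w \<in> set vs")
        case True
        then obtain i where "i < ?k" "w = vs ! i" by (auto simp: in_set_conv_nth)
        hence "p w \<in> set (0 # vs)" using path[of i] by (metis length_Cons less_SucI nth_mem)
        with vs show ?thesis by auto
      next
        case False
        hence "p w \<in> ?R \<union> insert 0 (set vs)" using pR[of w] w attach_sub[of w] by blast
        with vs show ?thesis by auto
      qed
      \<comment> \<open>Branch vertices are ranked by position in \<open>0 # vs\<close>; the offset
        \<open>Suc ?k\<close> lifts all others above them, as they may hang from the branch.\<close>
      define d' where "d' v = (if v \<in> ?R then Suc ?k + d v else idx v)" for v
      have idx_le: "idx v \<le> ?k" if v: "v \<in> set vs" for v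
      proof -
        obtain i where "i < ?k" "v = vs ! i" using v by (auto simp: in_set_conv_nth)
        thus ?thesis using idx[of "Suc i"] by simp
      qed
      have "d' (p w) < d' w" if w: "w \<in> {1..n}" "p w \<in> {1..n}" for w
      proof (cases "w \<in> set vs")
        case True
        then obtain i where i: "i < ?k" "w = vs ! i" by (auto simp: in_set_conv_nth)
        with path w(2) obtain j where j: "i = Suc j" by (cases i) auto
        have "p w = vs ! j" using path i j by simp
        moreover have "vs ! j \<notin> ?R" "w \<notin> ?R" using i j by auto
        moreover have "idx (vs ! j) = Suc j" "idx w = Suc i"
          using idx[of "Suc j"] idx[of "Suc i"] i j by auto
        ultimately show ?thesis using j by (simp only: d'_def if_False)
      next
        case False
        thus ?thesis using w d idx_le[of "p w"] by (auto simp: d'_def le_imp_less_Suc trans_le_add1)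
      qed
      hence "\<exists>d::nat \<Rightarrow> nat. \<forall>w\<in>{1..n}. p w \<in> {1..n} \<longrightarrow> d (p w) < d w" by blast
      moreover have "p \<in> PiE {1..n} (\<lambda>_. {1..n} \<union> {0})" using pV ext unfolding PiE_iff by blast
      ultimately have "p \<in> parent_functions n" unfolding forests_def by blast
      moreover have "max_branch p {1..n} 0 vs"
        unfolding max_branch_iff
      proof (intro conjI allI impI ballI)
        fix i assume i: "i < ?k"
        show "vs ! i \<in> {1..n}" using vs(2) nth_mem[OF i] by (rule subsetD)
        show "p (vs ! i) = (0 # vs) ! i" by (rule path[OF i])
      next
        \<comment> \<open>As \<open>0 # vs\<close> is distinct, a child of entry \<open>i\<close> is
          \<open>vs ! i\<close> itself or was attached at the same index, hence is below
          \<open>vs ! i\<close>.\<close>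
        fix i w assume i: "i < ?k" and w: "w \<in> {1..n}" "p w = (0 # vs) ! i"
        have nR: "p w \<notin> ?R" using w(2) i by (cases i) auto
        show "w \<le> vs ! i"
        proof (cases "w \<in> set vs")
          case True
          then obtain j where j: "j < ?k" "w = vs ! j" by (auto simp: in_set_conv_nth)
          have "(0 # vs) ! i = (0 # vs) ! j" using w(2) path[OF j(1)] unfolding j(2) by (rule trans[OF sym])
          hence "i = j" using nth_eq i j(1) by (meson less_imp_le)
          thus ?thesis using j(2) by simp
        next
          case False
          hence "p w \<in> attach_set vs w" using pR[of w] nR w by auto
          then obtain j where j: "j < ?k" "p w = (0 # vs) ! j" "w < vs ! j" by (auto simp: attach_set_def)
          have "(0 # vs) ! i = (0 # vs) ! j" using w(2) j(2) by (rule trans[OF sym])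
          hence "i = j" using nth_eq i j(1) by (meson less_imp_le)
          thus ?thesis using j(3) by simp
        qed
      next
        \<comment> \<open>Branch edges and attachments use only indices below \<open>?k\<close>, so
          the last vertex is childless.\<close>
        fix w assume w: "w \<in> {1..n}"
        show "p w \<noteq> (0 # vs) ! ?k"
        proof
          assume eq: "p w = (0 # vs) ! ?k"
          have "p w \<in> set (0 # vs)" using nth_mem[of ?k "0 # vs"] eq by simp
          hence nR: "p w \<notin> ?R" by auto
          show False
          proof (cases "w \<in> set vs")
            case True
            then obtain j where j: "j < ?k" "w = vs ! j" by (auto simp: in_set_conv_nth)
            have "(0 # vs) ! j = (0 # vs) ! ?k" using path[OF j(1)] eq unfolding j(2) by (rule trans[OF sym])
            hence "j = ?k" using nth_eq j(1) by (meson less_imp_le order_refl)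
            thus ?thesis using j(1) by simp
          next
            case False
            hence "p w \<in> attach_set vs w" using pR[of w] nR w by auto
            then obtain j where j: "j < ?k" "p w = (0 # vs) ! j" by (auto simp: attach_set_def)
            have "(0 # vs) ! j = (0 # vs) ! ?k" using j(2) eq by (rule trans[OF sym])
            hence "j = ?k" using nth_eq j(1) by (meson less_imp_le order_refl)
            thus ?thesis using j(1) by simp
          qed
        qed
      qed
      ultimately show "p \<in> {p \<in> parent_functions n. max_branch p {1..n} 0 vs}" by simp
    qed
  qed
  moreover have "{p \<in> parent_functions n. leg_vertices n (tree_of n p) = vs} =
      {p \<in> parent_functions n. max_branch p {1..n} 0 vs}"
    using leg_vertices_eq_iff by blast
  ultimately show ?thesis using card1 by simp
qed

section \<open>The center of a parking function\<close>

fun greedy_center :: "(nat \<Rightarrow> nat) \<Rightarrow> nat \<Rightarrow> nat set" where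
  "greedy_center a 0 = {}"
| "greedy_center a (Suc j) = (let Z = greedy_center a j in
     if a (Suc j) \<le> Suc (card Z) then insert (Suc j) Z else Z)"

lemma mem_greedy_center:
  "x \<in> greedy_center a n \<longleftrightarrow> x \<in> {1..n} \<and> a x \<le> Suc (card (greedy_center a (x - 1)))"
  by (induction n) (auto simp: Let_def le_Suc_eq)

lemma finite_greedy_center: "finite (greedy_center a n)"
  by (rule finite_subset[of _ "{1..n}"]) (use mem_greedy_center in auto)

lemma greedy_center_below:
  "x \<in> {1..n} \<Longrightarrow> {y \<in> greedy_center a n. y < x} = greedy_center a (x - 1)"
  by (auto simp: mem_greedy_center)

text \<open>Each greedy decision depends only on earlier ones. For a fixed \<open>X\<close> this
  turns the center into a separate bound on each value, so that the fiber count can split.\<close>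

lemma greedy_center_eq_iff:
  assumes "X \<subseteq> {1..n}"
  shows "greedy_center a n = X \<longleftrightarrow> (\<forall>x\<in>{1..n}. x \<in> X \<longleftrightarrow> a x \<le> Suc (card {y \<in> X. y < x}))"
proof
  assume X: "greedy_center a n = X"
  show "\<forall>x\<in>{1..n}. x \<in> X \<longleftrightarrow> a x \<le> Suc (card {y \<in> X. y < x})"
    unfolding X[symmetric] using greedy_center_below[of _ n a] mem_greedy_center[of _ a n] by simp
next
  assume char: "\<forall>x\<in>{1..n}. x \<in> X \<longleftrightarrow> a x \<le> Suc (card {y \<in> X. y < x})"
  have "greedy_center a j = {y \<in> X. y < Suc j}" if "j \<le> n" for j
    using that
  proof (induction j)
    case 0
    thus ?case using assms by auto
  next
    case (Suc j)
    have "Suc j \<in> X \<longleftrightarrow> a (Suc j) \<le> Suc (card {y \<in> X. y < Suc j})"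
      using char Suc.prems by auto
    moreover have "greedy_center a j = {y \<in> X. y < Suc j}" using Suc by simp
    ultimately show ?case by (auto simp: Let_def less_Suc_eq)
  qed
  from this[of n] assms show "greedy_center a n = X" by auto
qed

text \<open>The greedy set leads in every prefix: if an admissible \<open>X\<close> contains
  \<open>Suc j\<close>, the value there is at most one plus the number of earlier elements of
  \<open>X\<close>, so the greedy set takes \<open>Suc j\<close> too.\<close>

lemma center_size_greedy: "center_size n a = card (greedy_center a n)"
proof -
  have opt: "card {y \<in> X. y \<le> j} \<le> card (greedy_center a j)" if X: "center_ok n a X" and "j \<le> n" for X j
    using that(2)
  proof (induction j)
    case 0
    have "{y \<in> X. y \<le> 0} = {}" using X by (auto simp: center_ok_def)
    thus ?case by simp
  next
    case (Suc j)
    have fX: "finite X" using X finite_subset by (auto simp: center_ok_def)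
    have IH: "card {y \<in> X. y \<le> j} \<le> card (greedy_center a j)" using Suc by simp
    have nin: "Suc j \<notin> greedy_center a j" by (simp add: mem_greedy_center)
    show ?case
    proof (cases "Suc j \<in> X")
      case True
      hence "{y \<in> X. y \<le> Suc j} = insert (Suc j) {y \<in> X. y \<le> j}" by (auto simp: le_Suc_eq)
      hence c: "card {y \<in> X. y \<le> Suc j} = Suc (card {y \<in> X. y \<le> j})" using fX by simp
      moreover have "a (Suc j) \<le> card {y \<in> X. y \<le> Suc j}" using X True by (auto simp: center_ok_def)
      ultimately show ?thesis using IH nin finite_greedy_center[of a j] by (simp add: Let_def)
    next
      case False
      hence "{y \<in> X. y \<le> Suc j} = {y \<in> X. y \<le> j}" by (auto simp: le_Suc_eq)
      thus ?thesis using IH nin finite_greedy_center[of a j] by (simp add: Let_def)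
    qed
  qed
  have ok: "center_ok n a (greedy_center a n)"
    unfolding center_ok_def
  proof (intro conjI ballI)
    show "greedy_center a n \<subseteq> {1..n}" using mem_greedy_center by blast
    fix x assume x: "x \<in> greedy_center a n"
    have "{y \<in> greedy_center a n. y \<le> x} = insert x {y \<in> greedy_center a n. y < x}"
      using x by auto
    hence "card {y \<in> greedy_center a n. y \<le> x} = Suc (card {y \<in> greedy_center a n. y < x})"
      using finite_greedy_center[of a n] by simp
    thus "a x \<le> card {y \<in> greedy_center a n. y \<le> x}"
      using x greedy_center_below[of x n a] mem_greedy_center[of x a n] by simp
  qed
  show ?thesis unfolding center_size_def
  proof (rule Max_eqI)
    have "{card X | X. center_ok n a X} \<subseteq> card ` Pow {1..n}" by (auto simp: center_ok_def)
    thus "finite {card X | X. center_ok n a X}" by (rule finite_subset) simp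
    show "card (greedy_center a n) \<in> {card X | X. center_ok n a X}" using ok by blast
    fix c assume "c \<in> {card X | X. center_ok n a X}"
    then obtain X where X: "c = card X" "center_ok n a X" by blast
    hence "{y \<in> X. y \<le> n} = X" by (auto simp: center_ok_def)
    thus "c \<le> card (greedy_center a n)" using opt[OF X(2), of n] X(1) by simp
  qed
qed

section \<open>Parking functions with a prescribed center\<close>

lemma bij_betw_rank:
  fixes X :: "'a::linorder set"
  assumes "finite X"
  shows "bij_betw (\<lambda>x. Suc (card {y \<in> X. y < x})) X {1..card X}"
proof -
  let ?r = "\<lambda>x. Suc (card {y \<in> X. y < x})"
  have mono: "?r x < ?r x'" if "x \<in> X" "x < x'" for x x'
  proof -
    have "{y \<in> X. y < x} \<subset> {y \<in> X. y < x'}" using that by auto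
    thus ?thesis using assms by (simp add: psubset_card_mono)
  qed
  have inj: "inj_on ?r X"
    using mono by (metis (no_types, lifting) inj_onI linorder_neqE less_irrefl)
  moreover have "?r ` X \<subseteq> {1..card X}"
  proof clarify
    fix x assume "x \<in> X"
    hence "{y \<in> X. y < x} \<subset> X" by auto
    hence "card {y \<in> X. y < x} < card X" using assms psubset_card_mono by blast
    thus "?r x \<in> {1..card X}" by simp
  qed
  moreover have "card (?r ` X) = card {1..card X}" using inj by (simp add: card_image)
  ultimately show ?thesis by (simp add: bij_betw_def card_subset_eq)
qed

text \<open>Relative to a center \<open>X\<close>, these are the values at most \<open>card X + 1\<close> that a position
  \<open>w\<close> outside \<open>X\<close> can take without being picked by the greedy construction.\<close>

definition low_values :: "nat set \<Rightarrow> nat \<Rightarrow> nat set" where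
  "low_values X w = {card {y \<in> X. y < w} + 2..card X + 1}"

text \<open>The condition at \<open>i = n\<close> bounds all values by \<open>n\<close>.\<close>

lemma finite_parking_functions: "finite (parking_functions n)"
proof (rule finite_subset)
  show "finite (PiE {1..n} (\<lambda>_. {..n}))" by (intro finite_PiE) auto
  show "parking_functions n \<subseteq> PiE {1..n} (\<lambda>_. {..n})"
  proof
    fix a assume a: "a \<in> parking_functions n"
    have "a w \<le> n" if w: "w \<in> {1..n}" for w
    proof -
      have "n \<in> {1..n}" using w by auto
      hence "n \<le> card {j \<in> {1..n}. a j \<le> n}" using a unfolding parking_functions_def by blast
      hence "{j \<in> {1..n}. a j \<le> n} = {1..n}" by (intro card_seteq) auto
      with w show ?thesis by blast
    qed
    with a show "a \<in> PiE {1..n} (\<lambda>_. {..n})" by (simp add: parking_functions_def PiE_iff)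
  qed
qed

text \<open>On \<open>X\<close> the values range over \<open>{1..r x}\<close>, and the ranks run
  through \<open>1\<close> to \<open>card X\<close>, giving the factorial. Off \<open>X\<close> they
  must exceed \<open>r w\<close>.\<close>

lemma card_center_fiber:
  assumes X: "X \<subseteq> {1..n}"
  shows "card {a \<in> parking_functions n. greedy_center a n = X} =
    fact (card X) * card (parkings ({1..n} - X) (card X + 1) (low_values X))"
proof -
  define r where "r x = Suc (card {y \<in> X. y < x})" for x
  let ?R = "{1..n} - X" and ?k = "card X"
  have fX: "finite X" using X finite_subset by blast
  have bij: "bij_betw r X {1..?k}" using bij_betw_rank[OF fX] by (simp add: r_def[abs_def])
  have r_le: "r x \<le> Suc ?k" for x unfolding r_def using fX by (simp add: card_mono)
  have r_leX: "r x \<le> ?k" if "x \<in> X" for x using bij that by (auto simp: bij_betw_def)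
  have low: "low_values X w = {Suc (r w)..?k + 1}" for w by (simp add: low_values_def r_def)
  have cR: "card ?R = n - ?k" using X fX by (simp add: card_Diff_subset)
  have kn: "?k \<le> n" using X card_mono[of "{1..n}" X] by simp
  have U: "X \<union> ?R = {1..n}" using X by auto
  have "(\<Prod>x\<in>X. r x) = \<Prod>{1..?k}" using bij prod.reindex_bij_betw[OF bij, of id] by simp
  hence cM: "card (PiE X (\<lambda>x. {1..r x})) = fact ?k" using fX by (simp add: card_PiE fact_prod)
  have "card {a \<in> parking_functions n. greedy_center a n = X} =
      card (PiE X (\<lambda>x. {1..r x})) * card (parkings ?R (?k + 1) (low_values X))"
  proof (rule card_split_extensional[where S = X and R = ?R], unfold U)
    show "X \<inter> ?R = {}" by auto
    show "{a \<in> parking_functions n. greedy_center a n = X} \<subseteq> extensional {1..n}"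
      by (auto simp: parking_functions_def PiE_def)
    show "PiE X (\<lambda>x. {1..r x}) \<subseteq> extensional X" by (auto simp: PiE_def)
    show "parkings ?R (?k + 1) (low_values X) \<subseteq> extensional ?R" by (auto simp: parkings_def PiE_def)
    fix a :: "nat \<Rightarrow> nat" assume ext: "a \<in> extensional {1..n}"
    have Rst: "{w \<in> ?R. restrict a ?R w \<le> c} = {w \<in> ?R. a w \<le> c}" for c by auto
    have cnt: "card {j \<in> {1..n}. a j \<le> i} = card {j \<in> X. a j \<le> i} + card {j \<in> ?R. a j \<le> i}" for i
    proof -
      have "{j \<in> {1..n}. a j \<le> i} = {j \<in> X. a j \<le> i} \<union> {j \<in> ?R. a j \<le> i}" using X by auto
      moreover have "card ({j \<in> X. a j \<le> i} \<union> {j \<in> ?R. a j \<le> i}) =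
          card {j \<in> X. a j \<le> i} + card {j \<in> ?R. a j \<le> i}"
        using fX by (intro card_Un_disjoint) auto
      ultimately show ?thesis by simp
    qed
    have cX: "card {j \<in> X. a j \<le> i} \<le> ?k" for i using fX by (intro card_mono) auto
    show "a \<in> {a \<in> parking_functions n. greedy_center a n = X} \<longleftrightarrow>
      restrict a X \<in> PiE X (\<lambda>x. {1..r x}) \<and> restrict a ?R \<in> parkings ?R (?k + 1) (low_values X)"
    proof
      assume L: "a \<in> {a \<in> parking_functions n. greedy_center a n = X}"
      hence pos: "\<forall>x\<in>{1..n}. 1 \<le> a x" and pf: "\<forall>i\<in>{1..n}. i \<le> card {j \<in> {1..n}. a j \<le> i}"
        by (auto simp: parking_functions_def PiE_iff)
      have gr: "\<forall>x\<in>{1..n}. x \<in> X \<longleftrightarrow> a x \<le> r x"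
        using L greedy_center_eq_iff[OF X] by (simp add: r_def)
      have "a x \<in> {1..r x}" if "x \<in> X" for x using pos gr that X by auto
      moreover have "a w \<in> low_values X w \<union> {?k + 1<..}" if "w \<in> ?R" for w
        using gr that by (auto simp: low)
      \<comment> \<open>At least \<open>?k + 1 + i\<close> positions are counted and at most
        \<open>?k\<close> of them lie in \<open>X\<close>.\<close>
      moreover have "i < card {w \<in> ?R. a w \<le> ?k + 1 + i}" if "i < card ?R" for i
      proof -
        have "?k + 1 + i \<in> {1..n}" using that cR by auto
        hence "?k + 1 + i \<le> card {j \<in> {1..n}. a j \<le> ?k + 1 + i}" using pf by blast
        thus ?thesis using cnt[of "?k + 1 + i"] cX[of "?k + 1 + i"] by linarith
      qed
      ultimately show "restrict a X \<in> PiE X (\<lambda>x. {1..r x}) \<and>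
          restrict a ?R \<in> parkings ?R (?k + 1) (low_values X)"
        unfolding parkings_def using Rst by (simp add: PiE_iff)
    next
      assume Rt: "restrict a X \<in> PiE X (\<lambda>x. {1..r x}) \<and>
          restrict a ?R \<in> parkings ?R (?k + 1) (low_values X)"
      hence aX: "a x \<in> {1..r x}" if "x \<in> X" for x using that by (metis PiE_mem restrict_apply')
      have "\<forall>w\<in>?R. restrict a ?R w \<in> low_values X w \<union> {?k + 1<..}"
        using Rt unfolding parkings_def PiE_iff by blast
      hence aR: "a w \<in> low_values X w \<union> {?k + 1<..}" if "w \<in> ?R" for w using that by simp
      have "\<forall>i<card ?R. i < card {w \<in> ?R. restrict a ?R w \<le> ?k + 1 + i}"
        using Rt unfolding parkings_def by blast
      hence par: "i < card {w \<in> ?R. a w \<le> ?k + 1 + i}" if "i < card ?R" for i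
        using that unfolding Rst by blast
      have aR_gt: "r w < a w" if "w \<in> ?R" for w
        using aR[OF that] r_le[of w] by (auto simp: low)
      have "\<forall>x\<in>{1..n}. x \<in> X \<longleftrightarrow> a x \<le> r x" using aX aR_gt by (meson DiffI atLeastAtMost_iff not_le)
      hence "greedy_center a n = X" using greedy_center_eq_iff[OF X] by (simp add: r_def)
      moreover have "1 \<le> a x" if x: "x \<in> {1..n}" for x
        using aX[of x] aR_gt[of x] x by (cases "x \<in> X") auto
      moreover have "i \<le> card {j \<in> {1..n}. a j \<le> i}" if i: "i \<in> {1..n}" for i
      proof (cases "i \<le> ?k")
        case True
        \<comment> \<open>The elements of \<open>X\<close> of rank at most \<open>i\<close> already
          supply \<open>i\<close> values at most \<open>i\<close>.\<close>
        have "{1..i} \<subseteq> r ` {j \<in> X. a j \<le> i}"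
        proof
          fix c assume c: "c \<in> {1..i}"
          hence "c \<in> r ` X" using bij True by (auto simp: bij_betw_def)
          then obtain x where "x \<in> X" "c = r x" by blast
          with aX[of x] c show "c \<in> r ` {j \<in> X. a j \<le> i}" by force
        qed
        hence "card {1..i} \<le> card {j \<in> X. a j \<le> i}" using fX by (intro surj_card_le) auto
        thus ?thesis using cnt[of i] by simp
      next
        case False
        \<comment> \<open>Beyond \<open>?k\<close> all of \<open>X\<close> counts, and inequality
          \<open>i\<close> becomes index \<open>i - ?k - 1\<close> on the complement.\<close>
        hence "{j \<in> X. a j \<le> i} = X" using aX r_leX by fastforce
        moreover have "i - ?k - 1 < card ?R" "?k + 1 + (i - ?k - 1) = i" using False i cR by auto
        hence "i - ?k - 1 < card {w \<in> ?R. a w \<le> i}" using par by metis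
        ultimately show ?thesis using cnt[of i] False by simp
      qed
      ultimately show "a \<in> {a \<in> parking_functions n. greedy_center a n = X}"
        using ext by (simp add: parking_functions_def PiE_iff)
    qed
  qed
  with cM show ?thesis by simp
qed

section \<open>Comparison of the two sums\<close>

text \<open>All \<open>fact (card X)\<close> orderings of \<open>X\<close> as a branch contribute
  equally, by \<open>card_attach_set\<close>.\<close>

lemma card_leg_set_fiber:
  assumes X: "X \<subseteq> {1..n}"
  shows "card {p \<in> parent_functions n. set (leg_vertices n (tree_of n p)) = X} =
    fact (card X) * card (parkings ({1..n} - X) (card X + 1) (low_values X))"
proof -
  let ?L = "\<lambda>p. leg_vertices n (tree_of n p)" and ?R = "{1..n} - X"
  let ?A = "{p \<in> parent_functions n. set (?L p) = X}"
  have fX: "finite X" using X finite_subset by blast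
  have zero: "0 \<notin> X" using X by (metis atLeastAtMost_iff not_one_le_zero subsetD)
  have fiber: "card {p \<in> ?A. ?L p = vs} = card (parkings ?R (card X + 1) (low_values X))"
    if "vs \<in> permutations_of_set X" for vs
  proof -
    have vs: "distinct vs" "set vs = X" using that by (auto simp: permutations_of_set_def)
    have "{p \<in> ?A. ?L p = vs} = {p \<in> parent_functions n. ?L p = vs}" using vs by auto
    hence "card {p \<in> ?A. ?L p = vs} = card (forests ?R (attach_set vs))"
      using card_leg_vertices_fiber[of vs n] vs X by simp
    also have "\<dots> = card (parkings ?R (card X + 1) (low_values X))"
    proof (rule card_forests_eq_parkings)
      fix w assume w: "w \<in> ?R"
      show "finite (attach_set vs w)" by (simp add: attach_set_def)
      show "attach_set vs w \<inter> ?R = {}"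
        using vs by (auto simp: attach_set_def nth_Cons split: nat.splits)
      show "low_values X w \<subseteq> {..card X + 1}" by (auto simp: low_values_def)
      \<comment> \<open>As \<open>w\<close> is not in \<open>X\<close>, the elements above it number
        \<open>card X\<close> minus those below, the length of the interval
        \<open>low_values X w\<close>.\<close>
      have "X = {y \<in> X. y < w} \<union> {y \<in> X. w < y}"
        using w by (auto simp: linorder_not_less order_le_less)
      moreover have "card ({y \<in> X. y < w} \<union> {y \<in> X. w < y}) =
          card {y \<in> X. y < w} + card {y \<in> X. w < y}"
        using fX by (intro card_Un_disjoint) auto
      ultimately have "card X = card {y \<in> X. y < w} + card {y \<in> X. w < y}" by simp
      moreover have "card (attach_set vs w) = card {y \<in> X. w < y}"
        using card_attach_set[of vs w] vs zero by simp
      ultimately show "card (attach_set vs w) = card (low_values X w)"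
        by (simp add: low_values_def)
    qed simp
    finally show ?thesis .
  qed
  have "finite ?A" using finite_forests[of "{1..n}" "\<lambda>_. {0}"] by simp
  moreover have "?L ` ?A \<subseteq> permutations_of_set X"
    using leg_vertices_tree_of(2) by (auto simp: permutations_of_set_def)
  ultimately have "card ?A = (\<Sum>vs\<in>permutations_of_set X. card {p \<in> ?A. ?L p = vs})"
    by (intro card_fibers) simp_all
  also have "\<dots> = (\<Sum>vs\<in>permutations_of_set X. card (parkings ?R (card X + 1) (low_values X)))"
    using fiber by (intro sum.cong) simp_all
  finally show ?thesis using fX by simp
qed

lemma sum_monom_fibers:
  assumes "finite A" "finite I" "f ` A \<subseteq> I" "\<And>a. a \<in> A \<Longrightarrow> g a = h (f a)"
  shows "(\<Sum>a\<in>A. monom (1::int) (g a)) =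
    (\<Sum>i\<in>I. of_nat (card {a \<in> A. f a = i}) * monom 1 (h i))"
proof -
  have "(\<Sum>a\<in>A. monom (1::int) (g a)) = (\<Sum>i\<in>I. \<Sum>a\<in>{a \<in> A. f a = i}. monom 1 (g a))"
    using assms(1-3) by (simp add: sum.group)
  also have "\<dots> = (\<Sum>i\<in>I. \<Sum>a\<in>{a \<in> A. f a = i}. monom 1 (h i))"
    using assms(4) by (intro sum.cong) auto
  finally show ?thesis by simp
qed

theorem theorem2p1:
  fixes n :: nat
  assumes "0 < n"
  shows "(\<Sum>T\<in>labeled_trees n. monom (1::int) (leg n T))
       = (\<Sum>a\<in>parking_functions n. monom (1::int) (center_size n a))"
proof -
  let ?L = "\<lambda>p. leg_vertices n (tree_of n p)"
  have "(\<Sum>T\<in>labeled_trees n. monom (1::int) (leg n T)) =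
      (\<Sum>p\<in>parent_functions n. monom 1 (leg n (tree_of n p)))"
    by (rule sum.reindex_bij_betw[OF bij_betw_tree_of, symmetric])
  also have "\<dots> = (\<Sum>X\<in>Pow {1..n}. of_nat (card {p \<in> parent_functions n. set (?L p) = X}) *
      monom 1 (card X))"
  proof (rule sum_monom_fibers)
    show "finite (parent_functions n)" by (rule finite_forests) auto
    show "(\<lambda>p. set (?L p)) ` parent_functions n \<subseteq> Pow {1..n}"
      using leg_vertices_tree_of(3) by blast
    show "leg n (tree_of n p) = card (set (?L p))" if "p \<in> parent_functions n" for p
      using leg_vertices_tree_of(2)[OF that] by (simp add: leg_def distinct_card)
  qed simp
  \<comment> \<open>Branch sets and centers equal to the same \<open>X\<close> have fibers of the
    same size, by the two fiber counts.\<close>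
  also have "\<dots> = (\<Sum>X\<in>Pow {1..n}. of_nat (card {a \<in> parking_functions n. greedy_center a n = X}) *
      monom 1 (card X))"
    by (intro sum.cong refl) (simp only: Pow_iff card_leg_set_fiber card_center_fiber)
  also have "\<dots> = (\<Sum>a\<in>parking_functions n. monom 1 (center_size n a))"
  proof (rule sum_monom_fibers[symmetric])
    show "(\<lambda>a. greedy_center a n) ` parking_functions n \<subseteq> Pow {1..n}"
      using mem_greedy_center by blast
  qed (simp_all add: finite_parking_functions center_size_greedy)
  finally show ?thesis .
qed

end
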